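(* Let $\mathcal M$ be a (smooth, square, complex) matrix valued function on an open subset $U\subset M_\phi$, and let $m$ be an eigenvalue of $\mathcal M$ which is a smooth non constant function on $U$ with constant multiplicity. Suppose that there are matrix valued one-forms $d\mathcal M^+$, $d\mathcal M^-$ on $U$ and constants $k,r\in\mathbb C$ with $d\mathcal M^++d\mathcal M^-=k\,d\mathcal M$ such that $$N_\phi^*\,d\mathcal M=d\mathcal M^-\,\mathcal M+\mathcal M\,d\mathcal M^++r\,d\mathcal M .$$ Then $$N_\phi^*\,dm=(mk+r)\,dm ,$$ i.e. $mk+r$ is an eigenvalue of $N_\phi^*$ (at the points where $dm\neq0$).
   Context: **Setting.** Let $\mathfrak g$ be the compact form of a complex simple Lie algebra $\mathfrak g_{\mathbb C}$ of classical type, realized as a matrix algebra with $\mathfrak g=\{X\in\mathfrak g_{\mathbb C}: X^\dagger=-X\}$ (fundamental representation), and let $G$ be the corresponding compact connected matrix group. Fix a Cartan subalgebra $\mathfrak t\subset\mathfrak g$, roots $\Phi$, positive/negative roots $\Phi^\pm$, and root spaces $\mathfrak g_\alpha\subset\mathfrak g_{\mathbb C}$. Let $\phi$ be a non compact simple root: in every positive root, $\phi$ appears with coefficient $0$ (compact type, $\Phi_c^+$) or $1$ (non compact type). Put $\mathfrak h_\phi=\mathfrak t\oplus\bigoplus_{\alpha\in\Phi_c^+}(\mathfrak g_\alpha\oplus\mathfrak g_{-\alpha})\cap\mathfrak g$, with connected subgroup $H_\phi\subset G$; its center is one dimensional and $\rho_\phi\in Z(\mathfrak h_\phi)$ is normalized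 by $\phi(\rho_\phi)=i$. Identify $\mathfrak g^*\cong\mathfrak g$ by the trace form. $M_\phi=G/H_\phi$ is the adjoint orbit of $\rho_\phi$ through $\mu(gH_\phi)=g\rho_\phi g^{-1}$; for $X\in\mathfrak g$ put $\mu(X)={\rm Tr}(\mu X)$. The KKS Poisson bivector $\Omega_{kks}^{-1}$ is determined by $\{\mu(X),\mu(Y)\}_{kks}=\mu([X,Y])$. A bivector $\pi$ is viewed as a map $T^*M\to TM$ by $\langle\pi(\alpha),\beta\rangle=\langle\pi,\alpha\wedge\beta\rangle$, and $\Omega_{kks}:TM_\phi\to T^*M_\phi$ is the inverse of the map $\Omega_{kks}^{-1}$. **Bruhat-Poisson structure and Nijenhuis tensor.** $J:\mathfrak g_{\mathbb C}\to\mathfrak g_{\mathbb C}$ is linear with $J|_{\mathfrak t}=0$, $J(E_\alpha)=\pm iE_\alpha$ for $E_\alpha\in\mathfrak g_\alpha$, $\alpha\in\Phi^\pm$; $C_\pm=i\pm J$; $\mathfrak b_\pm=C_\pm(\mathfrak g)$. $\mathfrak g_{\mathbb C}=\mathfrak g\oplus\mathfrak b_-$ with projections ${\rm pr}_{\mathfrak g,-}$, ${\rm pr}_{\mathfrak b_-}$, and $\langle A,B\rangle={\rm Im}\,{\rm Tr}(AB)$. The standard Poisson-Lie structure $\pi_G$ on $G$ is, for $\xi,\eta\in\mathfrak g\cong\mathfrak g^*$, $$\langle r_{g^{-1}}\pi_G(g),\xi\wedge\eta\rangle=\langle {\rm pr}_{\mathfrak g,-}({\rm Ad}_{g^{-1}}C_-(\xi)),\,{\rm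 pr}_{\mathfrak b_-}({\rm Ad}_{g^{-1}}C_-(\eta))\rangle ,$$ where $r_{g^{-1}}$ is right translation to the identity. $\pi_0$ is the unique Poisson structure on $M_\phi$ making $(G,\pi_G)\to (M_\phi,\pi_0)$ a Poisson map. $N_\phi=\pi_0\circ\Omega_{kks}:TM_\phi\to TM_\phi$, and $N_\phi^*:T^*M_\phi\to T^*M_\phi$ is its dual, extended complex-linearly and applied entrywise to matrix-valued one-forms. (The symbols $d\mathcal M^\pm$ denote arbitrary matrix-valued one-forms; they need not be differentials.) *)

theory Defs
  imports "HOL-Analysis.Analysis" "HOL-Computational_Algebra.Polynomial"
begin

section \<open>Complex matrices\<close>

type_synonym 'n cmat = "complex ^ 'n ^ 'n"

definition cscale :: "complex \<Rightarrow> 'n::finite cmat \<Rightarrow> 'n cmat" (infixr "*\<^sub>C" 75)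
  where "c *\<^sub>C A = (\<chi> i j. c * A $ i $ j)"

definition dagger :: "'n::finite cmat \<Rightarrow> 'n cmat"
  where "dagger A = (\<chi> i j. cnj (A $ j $ i))"

definition lbr :: "'n::finite cmat \<Rightarrow> 'n cmat \<Rightarrow> 'n cmat"
  where "lbr A B = A ** B - B ** A"

text \<open>The library operations \<open>*\<close>, \<open>^\<close> and \<open>exp\<close> do not refer to the matrix product.
  Scalars in spans and derivatives are real; multiplication by complex scalars is \<^const>\<open>cscale\<close>.\<close>

definition mexp :: "'n::finite cmat \<Rightarrow> 'n cmat"
  where "mexp A = (\<Sum>j. ((\<lambda>B. A ** B) ^^ j) (mat 1) /\<^sub>R fact j)"

definition eigenvalue :: "'n::finite cmat \<Rightarrow> complex \<Rightarrow> bool"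
  where "eigenvalue A c \<longleftrightarrow> (\<exists>v::complex^'n. v \<noteq> 0 \<and> A *v v = c *s v)"

definition charpoly :: "'n::finite cmat \<Rightarrow> complex poly"
  where "charpoly A = det (\<chi> i j. (if i = j then [:0, 1:] else 0) - [:A $ i $ j:])"

definition alg_multiplicity :: "'n::finite cmat \<Rightarrow> complex \<Rightarrow> nat"
  where "alg_multiplicity A c = order c (charpoly A)"


section \<open>Embedded submanifolds of a Euclidean space\<close>

text \<open>A submanifold is given by its set \<open>S\<close> of points and by the map \<open>T\<close> sending a point to the
  tangent space there, a linear subspace of the ambient space. Covectors at a point are functions
  linear on the tangent space and, to make them unique, zero outside of it. With values in
  \<^typ>\<open>complex\<close> or in a space of matrices, these are the elements of the complexified cotangent
  space and the matrix-valued covectors.\<close>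

primrec Ck_on :: "nat \<Rightarrow> ('a::euclidean_space \<Rightarrow> 'b::real_normed_vector) \<Rightarrow> 'a set \<Rightarrow> bool"
  where
    "Ck_on 0 f W \<longleftrightarrow> continuous_on W f"
  | "Ck_on (Suc j) f W \<longleftrightarrow> (\<forall>x\<in>W. f differentiable (at x)) \<and>
       (\<forall>v. Ck_on j (\<lambda>x. frechet_derivative f (at x) v) W)"

definition smooth_map_on :: "'a set \<Rightarrow> ('a::euclidean_space \<Rightarrow> 'b::real_normed_vector) \<Rightarrow> bool"
  where "smooth_map_on S f \<longleftrightarrow>
    (\<forall>p\<in>S. \<exists>W F. open W \<and> p \<in> W \<and> (\<forall>j. Ck_on j F W) \<and> (\<forall>q\<in>S \<inter> W. F q = f q))"

definition covectors :: "'a::euclidean_space set \<Rightarrow> ('a \<Rightarrow> 'b::real_normed_vector) set"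
  where "covectors V = {\<alpha>. (\<forall>v\<in>V. \<forall>w\<in>V. \<alpha> (v + w) = \<alpha> v + \<alpha> w) \<and>
    (\<forall>c. \<forall>v\<in>V. \<alpha> (c *\<^sub>R v) = c *\<^sub>R \<alpha> v) \<and> (\<forall>v. v \<notin> V \<longrightarrow> \<alpha> v = 0)}"

text \<open>The derivative within \<open>S\<close> is unique only on vectors tangent to \<open>S\<close>.\<close>

definition differential :: "('a \<Rightarrow> 'a set) \<Rightarrow> 'a set \<Rightarrow>
    ('a::euclidean_space \<Rightarrow> 'b::real_normed_vector) \<Rightarrow> 'a \<Rightarrow> 'a \<Rightarrow> 'b"
  where "differential T S f p =
    (\<lambda>v. if v \<in> T p then frechet_derivative f (at p within S) v else 0)"

definition smooth_one_form_on :: "('a \<Rightarrow> 'a set) \<Rightarrow> 'a set \<Rightarrow>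
    ('a::euclidean_space \<Rightarrow> 'a \<Rightarrow> 'b::real_normed_vector) \<Rightarrow> bool"
  where "smooth_one_form_on T S \<omega> \<longleftrightarrow> (\<forall>p\<in>S. \<omega> p \<in> covectors (T p)) \<and>
    (\<forall>p\<in>S. \<exists>W \<theta>. open W \<and> p \<in> W \<and> (\<forall>x\<in>W. linear (\<theta> x)) \<and>
      (\<forall>v j. Ck_on j (\<lambda>x. \<theta> x v) W) \<and> (\<forall>x\<in>S \<inter> W. \<forall>v\<in>T x. \<theta> x v = \<omega> x v))"

text \<open>The dual of an endomorphism \<open>L\<close> of the tangent space \<open>V\<close>. On complex-valued covectors it is
  the complex-linear extension of the dual on real ones, on matrix-valued covectors it acts
  entrywise.\<close>

definition dual_map ::
    "'a::euclidean_space set \<Rightarrow> ('a \<Rightarrow> 'a) \<Rightarrow> ('a \<Rightarrow> 'b::real_normed_vector) \<Rightarrow> 'a \<Rightarrow> 'b"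
  where "dual_map V L \<alpha> = (\<lambda>v. if v \<in> V then \<alpha> (L v) else 0)"

text \<open>Elements of the second exterior power of \<open>V\<close> are the alternating bilinear maps on covectors,
  a bivector \<open>b\<close> having the value \<open>b \<alpha> \<beta>\<close> on \<open>\<alpha> \<and> \<beta>\<close>.\<close>

type_synonym 'a bivec = "('a \<Rightarrow> real) \<Rightarrow> ('a \<Rightarrow> real) \<Rightarrow> real"

definition bivector :: "'a::euclidean_space set \<Rightarrow> 'a bivec \<Rightarrow> bool"
  where "bivector V b \<longleftrightarrow>
    (\<forall>\<alpha>\<in>covectors V. \<forall>\<beta>\<in>covectors V. b \<alpha> \<beta> = - b \<beta> \<alpha>) \<and>
    (\<forall>\<alpha>\<in>covectors V. \<forall>\<beta>\<in>covectors V. \<forall>\<gamma>\<in>covectors V. \<forall>x y.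
      b \<alpha> (\<lambda>v. x * \<beta> v + y * \<gamma> v) = x * b \<alpha> \<beta> + y * b \<alpha> \<gamma>)"

definition sharp :: "'a::euclidean_space set \<Rightarrow> 'a bivec \<Rightarrow> ('a \<Rightarrow> real) \<Rightarrow> 'a"
  where "sharp V b \<alpha> = (THE v. v \<in> V \<and> (\<forall>\<beta>\<in>covectors V. \<beta> v = b \<alpha> \<beta>))"

definition poisson_bracket :: "('a \<Rightarrow> 'a set) \<Rightarrow> 'a set \<Rightarrow> ('a::euclidean_space \<Rightarrow> 'a bivec) \<Rightarrow>
    ('a \<Rightarrow> real) \<Rightarrow> ('a \<Rightarrow> real) \<Rightarrow> 'a \<Rightarrow> real"
  where "poisson_bracket T S \<pi> f h = (\<lambda>p. \<pi> p (differential T S f p) (differential T S h p))"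

definition poisson_structure ::
    "('a \<Rightarrow> 'a set) \<Rightarrow> 'a set \<Rightarrow> ('a::euclidean_space \<Rightarrow> 'a bivec) \<Rightarrow> bool"
  where "poisson_structure T S \<pi> \<longleftrightarrow>
    (\<forall>p\<in>S. bivector (T p) (\<pi> p)) \<and>
    (\<forall>f h. smooth_map_on S f \<longrightarrow> smooth_map_on S h \<longrightarrow>
      smooth_map_on S (poisson_bracket T S \<pi> f h)) \<and>
    (\<forall>f h l. smooth_map_on S f \<longrightarrow> smooth_map_on S h \<longrightarrow> smooth_map_on S l \<longrightarrow>
      (\<forall>p\<in>S. poisson_bracket T S \<pi> f (poisson_bracket T S \<pi> h l) p
           + poisson_bracket T S \<pi> h (poisson_bracket T S \<pi> l f) p
           + poisson_bracket T S \<pi> l (poisson_bracket T S \<pi> f h) p = 0))"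


section \<open>Classical Lie algebras, their compact forms and groups\<close>

definition form_algebra :: "'n::finite cmat \<Rightarrow> 'n cmat set"
  where "form_algebra B = {X. transpose X ** B + B ** X = 0}"

text \<open>Unitarity of the matrix \<open>B\<close> of the invariant form makes the algebra closed under
  \<^const>\<open>dagger\<close>, so that its anti-hermitian part is a compact real form. The bounds on the size
  are those for which the algebra is simple.\<close>

definition classical_simple :: "'n::finite cmat set \<Rightarrow> bool"
  where "classical_simple gC \<longleftrightarrow>
    (CARD('n) \<ge> 2 \<and> gC = {X. trace X = 0}) \<or>
    (CARD('n) \<ge> 3 \<and> CARD('n) \<noteq> 4 \<and>
      (\<exists>B. dagger B ** B = mat 1 \<and> transpose B = B \<and> gC = form_algebra B)) \<or>
    (\<exists>B. dagger B ** B = mat 1 \<and> transpose B = - B \<and> gC = form_algebra B)"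

definition compact_form :: "'n::finite cmat set \<Rightarrow> 'n cmat set"
  where "compact_form gC = {X \<in> gC. dagger X = - X}"

text \<open>The connected matrix group with Lie algebra \<open>compact_form gC\<close> is generated by exponentials.
  Inverses need no clause, as \<open>mexp (- X)\<close> is the inverse of \<open>mexp X\<close>.\<close>

inductive_set compact_group :: "'n::finite cmat set \<Rightarrow> 'n cmat set" for gC
  where
    one: "mat 1 \<in> compact_group gC"
  | mult: "a \<in> compact_group gC \<Longrightarrow> X \<in> compact_form gC \<Longrightarrow> a ** mexp X \<in> compact_group gC"

definition cartan :: "'n::finite cmat set \<Rightarrow> 'n cmat set \<Rightarrow> bool"
  where "cartan gC t \<longleftrightarrow> subspace t \<and> t \<subseteq> compact_form gC \<and> (\<forall>X\<in>t. \<forall>Y\<in>t. lbr X Y = 0) \<and>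
    (\<forall>X\<in>compact_form gC. (\<forall>H\<in>t. lbr H X = 0) \<longrightarrow> X \<in> t)"

text \<open>Roots are functionals on the real Cartan subalgebra \<open>t\<close>, on which they take imaginary values.
  They are zero outside of \<open>t\<close>, to make them unique as functions. Linearity on \<open>t\<close> follows from the
  root space being nonzero.\<close>

type_synonym 'n functional = "'n cmat \<Rightarrow> complex"

definition root_space :: "'n::finite cmat set \<Rightarrow> 'n cmat set \<Rightarrow> 'n functional \<Rightarrow> 'n cmat set"
  where "root_space gC t \<alpha> = {E \<in> gC. \<forall>H\<in>t. lbr H E = \<alpha> H *\<^sub>C E}"

definition roots :: "'n::finite cmat set \<Rightarrow> 'n cmat set \<Rightarrow> ('n functional) set"
  where "roots gC t = {\<alpha>. (\<forall>H. H \<notin> t \<longrightarrow> \<alpha> H = 0) \<and> (\<exists>H\<in>t. \<alpha> H \<noteq> 0) \<and>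
    (\<exists>E\<in>root_space gC t \<alpha>. E \<noteq> 0)}"

definition nat_comb :: "('n::finite functional) set \<Rightarrow> ('n functional \<Rightarrow> nat) \<Rightarrow> 'n functional"
  where "nat_comb \<Delta> c = (\<lambda>H. \<Sum>\<delta>\<in>\<Delta>. of_nat (c \<delta>) * \<delta> H)"

definition simple_roots :: "'n::finite cmat set \<Rightarrow> 'n cmat set \<Rightarrow> ('n functional) set \<Rightarrow> bool"
  where "simple_roots gC t \<Delta> \<longleftrightarrow> finite \<Delta> \<and> \<Delta> \<subseteq> roots gC t \<and>
    (\<forall>c :: 'n functional \<Rightarrow> real.
      (\<forall>H\<in>t. (\<Sum>\<delta>\<in>\<Delta>. of_real (c \<delta>) * \<delta> H) = 0) \<longrightarrow> (\<forall>\<delta>\<in>\<Delta>. c \<delta> = 0)) \<and>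
    (\<forall>\<alpha>\<in>roots gC t. \<exists>c. \<alpha> = nat_comb \<Delta> c \<or> \<alpha> = (\<lambda>H. - nat_comb \<Delta> c H))"

definition positive_roots ::
    "'n::finite cmat set \<Rightarrow> 'n cmat set \<Rightarrow> ('n functional) set \<Rightarrow> ('n functional) set"
  where "positive_roots gC t \<Delta> = {\<alpha> \<in> roots gC t. \<exists>c. \<alpha> = nat_comb \<Delta> c}"

definition noncompact_simple_root ::
    "'n::finite cmat set \<Rightarrow> 'n cmat set \<Rightarrow> ('n functional) set \<Rightarrow> 'n functional \<Rightarrow> bool"
  where "noncompact_simple_root gC t \<Delta> \<phi> \<longleftrightarrow> \<phi> \<in> \<Delta> \<and>
    (\<forall>\<alpha>\<in>positive_roots gC t \<Delta>. \<forall>c. \<alpha> = nat_comb \<Delta> c \<longrightarrow> c \<phi> = 0 \<or> c \<phi> = 1)"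

definition compact_positive_roots ::
    "'n::finite cmat set \<Rightarrow> 'n cmat set \<Rightarrow> ('n functional) set \<Rightarrow> 'n functional \<Rightarrow> ('n functional) set"
  where "compact_positive_roots gC t \<Delta> \<phi> =
    {\<alpha> \<in> positive_roots gC t \<Delta>. \<exists>c. \<alpha> = nat_comb \<Delta> c \<and> c \<phi> = 0}"

definition h_subalgebra ::
    "'n::finite cmat set \<Rightarrow> 'n cmat set \<Rightarrow> ('n functional) set \<Rightarrow> 'n functional \<Rightarrow> 'n cmat set"
  where "h_subalgebra gC t \<Delta> \<phi> = span (t \<union> (\<Union>\<alpha>\<in>compact_positive_roots gC t \<Delta> \<phi>.
    {A + B | A B. A \<in> root_space gC t \<alpha> \<and> B \<in> root_space gC t (\<lambda>H. - \<alpha> H)} \<inter> compact_form gC))"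

definition center :: "'n::finite cmat set \<Rightarrow> 'n cmat set"
  where "center h = {Z \<in> h. \<forall>X\<in>h. lbr Z X = 0}"


section \<open>The adjoint orbit and its Poisson structures\<close>

definition orbit_map :: "'n::finite cmat \<Rightarrow> 'n cmat \<Rightarrow> 'n cmat"
  where "orbit_map \<rho> a = a ** \<rho> ** matrix_inv a"

definition orbit :: "'n::finite cmat set \<Rightarrow> 'n cmat \<Rightarrow> 'n cmat set"
  where "orbit gC \<rho> = orbit_map \<rho> ` compact_group gC"

definition orbit_tangent :: "'n::finite cmat set \<Rightarrow> 'n cmat \<Rightarrow> 'n cmat set"
  where "orbit_tangent gC p = (\<lambda>X. lbr X p) ` compact_form gC"

definition group_tangent :: "'n::finite cmat set \<Rightarrow> 'n cmat \<Rightarrow> 'n cmat set"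
  where "group_tangent gC a = (\<lambda>X. X ** a) ` compact_form gC"

text \<open>The component of the moment map along \<open>X\<close>. On anti-hermitian matrices the trace form is
  real.\<close>

definition moment :: "'n::finite cmat \<Rightarrow> 'n cmat \<Rightarrow> real"
  where "moment X p = Re (trace (p ** X))"

definition kks_bivector :: "'n::finite cmat set \<Rightarrow> 'n cmat \<Rightarrow> ('n cmat \<Rightarrow> 'n cmat bivec) \<Rightarrow> bool"
  where "kks_bivector gC \<rho> \<pi> \<longleftrightarrow> poisson_structure (orbit_tangent gC) (orbit gC \<rho>) \<pi> \<and>
    (\<forall>X\<in>compact_form gC. \<forall>Y\<in>compact_form gC. \<forall>p\<in>orbit gC \<rho>.
      poisson_bracket (orbit_tangent gC) (orbit gC \<rho>) \<pi> (moment X) (moment Y) p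
        = moment (lbr X Y) p)"

text \<open>\<open>J\<close> matters only on \<open>gC\<close>.\<close>

definition J_map :: "'n::finite cmat set \<Rightarrow> 'n cmat set \<Rightarrow> ('n functional) set \<Rightarrow>
    ('n cmat \<Rightarrow> 'n cmat) \<Rightarrow> bool"
  where "J_map gC t \<Delta> J \<longleftrightarrow>
    (\<forall>X\<in>gC. \<forall>Y\<in>gC. J (X + Y) = J X + J Y) \<and>
    (\<forall>c. \<forall>X\<in>gC. J (c *\<^sub>C X) = c *\<^sub>C J X) \<and>
    (\<forall>H\<in>t. J H = 0) \<and>
    (\<forall>\<alpha>\<in>positive_roots gC t \<Delta>. \<forall>E\<in>root_space gC t \<alpha>. J E = \<i> *\<^sub>C E) \<and>
    (\<forall>\<alpha>\<in>positive_roots gC t \<Delta>. \<forall>E\<in>root_space gC t (\<lambda>H. - \<alpha> H). J E = (- \<i>) *\<^sub>C E)"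

definition C_minus :: "('n::finite cmat \<Rightarrow> 'n cmat) \<Rightarrow> 'n cmat \<Rightarrow> 'n cmat"
  where "C_minus J X = \<i> *\<^sub>C X - J X"

definition b_minus :: "'n::finite cmat set \<Rightarrow> ('n cmat \<Rightarrow> 'n cmat) \<Rightarrow> 'n cmat set"
  where "b_minus gC J = C_minus J ` compact_form gC"

definition pr_g :: "'n::finite cmat set \<Rightarrow> ('n cmat \<Rightarrow> 'n cmat) \<Rightarrow> 'n cmat \<Rightarrow> 'n cmat"
  where "pr_g gC J Y = (THE A. A \<in> compact_form gC \<and> Y - A \<in> b_minus gC J)"

definition pr_b :: "'n::finite cmat set \<Rightarrow> ('n cmat \<Rightarrow> 'n cmat) \<Rightarrow> 'n cmat \<Rightarrow> 'n cmat"
  where "pr_b gC J Y = (THE B. B \<in> b_minus gC J \<and> Y - B \<in> compact_form gC)"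

text \<open>The covector at \<open>a\<close> whose right translate to the identity is \<open>\<xi>\<close>, regarded as a functional
  on the Lie algebra by the trace form.\<close>

definition right_covector :: "'n::finite cmat set \<Rightarrow> 'n cmat \<Rightarrow> 'n cmat \<Rightarrow> 'n cmat \<Rightarrow> real"
  where "right_covector gC \<xi> a =
    (\<lambda>v. if v \<in> group_tangent gC a then Re (trace (\<xi> ** (v ** matrix_inv a))) else 0)"

definition standard_poisson_lie :: "'n::finite cmat set \<Rightarrow> ('n cmat \<Rightarrow> 'n cmat) \<Rightarrow>
    ('n cmat \<Rightarrow> 'n cmat bivec) \<Rightarrow> bool"
  where "standard_poisson_lie gC J \<pi>G \<longleftrightarrow>
    (\<forall>a\<in>compact_group gC. bivector (group_tangent gC a) (\<pi>G a) \<and>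
      (\<forall>\<xi>\<in>compact_form gC. \<forall>\<eta>\<in>compact_form gC.
        \<pi>G a (right_covector gC \<xi> a) (right_covector gC \<eta> a)
          = Im (trace (pr_g gC J (matrix_inv a ** C_minus J \<xi> ** a)
                    ** pr_b gC J (matrix_inv a ** C_minus J \<eta> ** a)))))"

text \<open>The orbit map being Poisson is expressed by relatedness of the two bivectors, covectors
  being pulled back from the orbit to the group by the dual of the differential of the orbit map.\<close>

definition pullback_orbit_map ::
    "'n::finite cmat set \<Rightarrow> 'n cmat \<Rightarrow> 'n cmat \<Rightarrow> ('n cmat \<Rightarrow> real) \<Rightarrow> 'n cmat \<Rightarrow> real"
  where "pullback_orbit_map gC \<rho> a =
    dual_map (group_tangent gC a)
      (differential (group_tangent gC) (compact_group gC) (orbit_map \<rho>) a)"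

definition bruhat_poisson :: "'n::finite cmat set \<Rightarrow> 'n cmat \<Rightarrow> ('n cmat \<Rightarrow> 'n cmat bivec) \<Rightarrow>
    ('n cmat \<Rightarrow> 'n cmat bivec) \<Rightarrow> bool"
  where "bruhat_poisson gC \<rho> \<pi>G \<pi>0 \<longleftrightarrow>
    poisson_structure (orbit_tangent gC) (orbit gC \<rho>) \<pi>0 \<and>
    (\<forall>a\<in>compact_group gC. \<forall>\<alpha>\<in>covectors (orbit_tangent gC (orbit_map \<rho> a)).
      \<forall>\<beta>\<in>covectors (orbit_tangent gC (orbit_map \<rho> a)).
        \<pi>0 (orbit_map \<rho> a) \<alpha> \<beta>
          = \<pi>G a (pullback_orbit_map gC \<rho> a \<alpha>) (pullback_orbit_map gC \<rho> a \<beta>))"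

definition kks_form :: "'n::finite cmat set \<Rightarrow> ('n cmat \<Rightarrow> 'n cmat bivec) \<Rightarrow>
    'n cmat \<Rightarrow> 'n cmat \<Rightarrow> 'n cmat \<Rightarrow> real"
  where "kks_form gC \<pi>kks p =
    inv_into (covectors (orbit_tangent gC p)) (sharp (orbit_tangent gC p) (\<pi>kks p))"

definition nijenhuis :: "'n::finite cmat set \<Rightarrow> ('n cmat \<Rightarrow> 'n cmat bivec) \<Rightarrow>
    ('n cmat \<Rightarrow> 'n cmat bivec) \<Rightarrow> 'n cmat \<Rightarrow> 'n cmat \<Rightarrow> 'n cmat"
  where "nijenhuis gC \<pi>0 \<pi>kks p = sharp (orbit_tangent gC p) (\<pi>0 p) \<circ> kks_form gC \<pi>kks p"

definition nijenhuis_dual :: "'n::finite cmat set \<Rightarrow> ('n cmat \<Rightarrow> 'n cmat bivec) \<Rightarrow>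
    ('n cmat \<Rightarrow> 'n cmat bivec) \<Rightarrow> 'n cmat \<Rightarrow>
    ('n cmat \<Rightarrow> 'b::real_normed_vector) \<Rightarrow> 'n cmat \<Rightarrow> 'b"
  where "nijenhuis_dual gC \<pi>0 \<pi>kks p =
    dual_map (orbit_tangent gC p) (nijenhuis gC \<pi>0 \<pi>kks p)"

end

(*
  Let chi(p, x) be the characteristic polynomial of M(p). In the derivative of the determinant of
  B = x - M the terms B C and C B both contribute tr(C) det B, so the hypothesis on N* dM gives
  N* d chi = (k x + r) d chi + s chi for some s. Since (x - m)^d divides chi everywhere, it also
  divides d chi + chi' dm, where the prime is differentiation in x. Combining the two, (x - m)^d
  divides (N* dm - (k x + r) dm) chi'. But chi' has order exactly d - 1 at m, so the first factor
  vanishes at x = m. A tangent vector v and its image N v are realized as velocities of two curves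
  through p, so that only derivatives of one-parameter families of matrices are needed.
*)

theory Submission
  imports Defs
begin

section \<open>Curves in the orbit\<close>

text \<open>In finite dimension every bilinear map is bounded. The interpretation that follows
  thereby supplies the product rule, a norm estimate and termwise multiplication of series for
  \<open>**\<close>.\<close>

lemma bounded_bilinear_matrix_mult:
  "bounded_bilinear ((**) :: complex^'n::finite^'n \<Rightarrow> complex^'n^'n \<Rightarrow> complex^'n^'n)"
  unfolding bilinear_conv_bounded_bilinear[symmetric] bilinear_def
  by (intro conjI allI linearI)
    (simp_all add: vec_eq_iff matrix_matrix_mult_def sum.distrib scaleR_sum_right distrib_left distrib_right)

interpretation matrix_mult: bounded_bilinear
  "(**) :: complex^'n::finite^'n \<Rightarrow> complex^'n^'n \<Rightarrow> complex^'n^'n"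
  by (rule bounded_bilinear_matrix_mult)

text \<open>Every basis vector is some \<open>axis i u\<close>, so components with respect to the
  basis only see one entry. Two applications reduce a matrix to its complex entries.\<close>

lemma has_vector_derivative_vec:
  fixes f :: "real \<Rightarrow> 'a::euclidean_space ^ 'n"
  assumes "\<And>i. ((\<lambda>t. f t $ i) has_vector_derivative f' $ i) (at x within S)"
  shows "(f has_vector_derivative f') (at x within S)"
  unfolding has_vector_derivative_def
proof (subst has_derivative_componentwise_within, rule ballI)
  fix b :: "'a ^ 'n"
  assume "b \<in> Basis"
  then obtain i u where "b = axis i u"
    by (auto simp: Basis_vec_def)
  then have "v \<bullet> b = v $ i \<bullet> u" for v
    by (simp add: inner_axis)
  then show "((\<lambda>t. f t \<bullet> b) has_derivative (\<lambda>t. (t *\<^sub>R f') \<bullet> b)) (at x within S)"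
    using bounded_linear.has_derivative[OF bounded_linear_inner_left
        assms[of i, unfolded has_vector_derivative_def], of u]
    by (simp only: vector_scaleR_component)
qed

section \<open>The matrix exponential and its one-parameter groups\<close>

definition mpow :: "'n::finite cmat \<Rightarrow> nat \<Rightarrow> 'n cmat" where
  "mpow X j = ((\<lambda>B. X ** B) ^^ j) (mat 1)"

lemma mpow_0: "mpow X 0 = mat 1" and mpow_Suc: "mpow X (Suc j) = X ** mpow X j"
  by (simp_all add: mpow_def)

lemma mpow_Suc_right: "mpow X (Suc j) = mpow X j ** X"
proof (induction j)
  case (Suc j)
  have "mpow X (Suc (Suc j)) = X ** (mpow X j ** X)"
    by (simp only: mpow_Suc[of X "Suc j"] Suc)
  then show ?case
    by (simp only: matrix_mul_assoc mpow_Suc[of X j])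
qed (simp add: mpow_0 mpow_Suc)

lemma mpow_scaleR: "mpow (t *\<^sub>R X) j = t ^ j *\<^sub>R mpow X j"
  by (induction j) (simp_all add: mpow_0 mpow_Suc matrix_mult.scaleR_left matrix_mult.scaleR_right)

lemma mexp_mpow: "mexp X = (\<Sum>j. mpow X j /\<^sub>R fact j)"
  by (simp add: mexp_def mpow_def)

text \<open>The estimate from bilinearity carries a constant, which is absorbed into the base
  \<open>norm X * K\<close> of a geometric bound. This makes the exponential series comparable with
  a scalar one.\<close>

lemma norm_mpow_le:
  fixes X :: "'n::finite cmat"
  shows "\<exists>K\<ge>0. \<forall>j. norm (mpow X j) \<le> K ^ j * norm (mat 1 :: 'n cmat)"
proof -
  have "\<exists>K\<ge>0. \<forall>(A :: 'n cmat) (B :: 'n cmat). norm (A ** B) \<le> norm A * norm B * K"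
    by (rule matrix_mult.nonneg_bounded)
  then obtain K where K: "\<And>(A :: 'n cmat) (B :: 'n cmat). norm (A ** B) \<le> norm A * norm B * K" "K \<ge> 0"
    by blast
  have "norm (mpow X j) \<le> (norm X * K) ^ j * norm (mat 1 :: 'n cmat)" for j
  proof (induction j)
    case (Suc j)
    have "norm (mpow X (Suc j)) \<le> norm X * K * norm (mpow X j)"
      using K(1)[of X "mpow X j"] by (simp add: mpow_Suc mult_ac)
    also have "\<dots> \<le> norm X * K * ((norm X * K) ^ j * norm (mat 1 :: 'n cmat))"
      using Suc K(2) by (intro mult_left_mono) auto
    finally show ?case
      by (simp add: mult_ac)
  qed (simp add: mpow_0)
  then show ?thesis
    using K(2) by (intro exI[of _ "norm X * K"]) auto
qed

lemma summable_mpow: "summable (\<lambda>j. mpow X j /\<^sub>R fact j)"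
proof -
  obtain K where K: "K \<ge> 0" "\<And>j. norm (mpow X j) \<le> K ^ j * norm (mat 1 :: 'a cmat)"
    using norm_mpow_le[of X] by blast
  show ?thesis
  proof (rule summable_comparison_test')
    show "summable (\<lambda>j. (K ^ j /\<^sub>R fact j) * norm (mat 1 :: 'a cmat))"
      by (intro summable_mult2 summable_exp_generic)
    show "norm (mpow X j /\<^sub>R fact j) \<le> (K ^ j /\<^sub>R fact j) * norm (mat 1 :: 'a cmat)" for j
      using mult_left_mono[OF K(2)[of j], of "inverse (fact j)"] by (simp add: mult.assoc)
  qed
qed

text \<open>\<open>X\<close> commutes with its powers, and multiplication by \<open>X\<close> on
  either side is continuous and so passes through the series.\<close>

lemma mexp_commute: "X ** mexp X = mexp X ** X"
proof -
  have "X ** mexp X = (\<Sum>j. X ** (mpow X j /\<^sub>R fact j))"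
    unfolding mexp_mpow
    by (rule bounded_linear.suminf[OF matrix_mult.bounded_linear_right summable_mpow])
  also have "\<dots> = (\<Sum>j. (mpow X j /\<^sub>R fact j) ** X)"
    by (simp add: matrix_mult.scaleR_left matrix_mult.scaleR_right mpow_Suc_right flip: mpow_Suc)
  also have "\<dots> = mexp X ** X"
    unfolding mexp_mpow
    by (rule bounded_linear.suminf[OF matrix_mult.bounded_linear_left summable_mpow, symmetric])
  finally show ?thesis .
qed

lemma mexp_0: "mexp 0 = mat 1"
proof -
  have "mpow (0 :: 'a cmat) j /\<^sub>R fact j = (if j = 0 then mat 1 else 0)" for j
    by (cases j) (simp_all add: mpow_0 mpow_Suc matrix_mult.zero_left)
  then have "(\<lambda>j. mpow (0 :: 'a cmat) j /\<^sub>R fact j) sums mat 1"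
    using sums_single[of 0 "\<lambda>_. mat 1 :: 'a cmat"] by simp
  then show ?thesis
    unfolding mexp_mpow by (rule sums_unique[symmetric])
qed

text \<open>Each entry is a complex power series in \<open>t\<close> that converges everywhere. It
  is differentiated termwise, and the complex derivative is then restricted to real
  \<open>t\<close>.\<close>

lemma mexp_has_vector_derivative:
  "((\<lambda>t. mexp (t *\<^sub>R X)) has_vector_derivative X ** mexp (t *\<^sub>R X)) (at t)"
proof (rule has_vector_derivative_vec, rule has_vector_derivative_vec)
  fix i j
  have bl: "bounded_linear (\<lambda>A :: 'a cmat. A $ i $ j)" for i j
    by (intro bounded_linear_compose[OF bounded_linear_vec_nth bounded_linear_vec_nth])
  define c where "c n = (mpow X n /\<^sub>R fact n) $ i $ j" for n
  obtain K where K: "K \<ge> 0" "\<And>j. norm (mpow X j) \<le> K ^ j * norm (mat 1 :: 'a cmat)"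
    using norm_mpow_le[of X] by blast
  have "summable (\<lambda>n. c n * z ^ n)" for z
  proof (rule summable_comparison_test')
    show "summable (\<lambda>j. ((K * norm z) ^ j /\<^sub>R fact j) * norm (mat 1 :: 'a cmat))"
      by (intro summable_mult2 summable_exp_generic)
    fix n
    have "norm (mpow X n $ i $ j) \<le> norm (mpow X n)"
      by (rule order_trans[OF Finite_Cartesian_Product.norm_nth_le Finite_Cartesian_Product.norm_nth_le])
    then have "norm (mpow X n $ i $ j) * norm z ^ n / fact n \<le> K ^ n * norm (mat 1 :: 'a cmat) * norm z ^ n / fact n"
      using K(2)[of n] by (intro divide_right_mono mult_right_mono) auto
    then show "norm (c n * z ^ n) \<le> ((K * norm z) ^ n /\<^sub>R fact n) * norm (mat 1 :: 'a cmat)"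
      by (simp add: c_def norm_mult norm_power power_mult_distrib divide_inverse mult_ac)
  qed
  then have deriv: "((\<lambda>z. \<Sum>n. c n * z ^ n) has_field_derivative (\<Sum>n. diffs c n * of_real t ^ n)) (at (of_real t))"
    by (rule termdiffs_strong_converges_everywhere)
  have entry: "mexp (s *\<^sub>R X) $ i $ j = (\<Sum>n. c n * of_real s ^ n)" for s
    unfolding mexp_mpow bounded_linear.suminf[OF bl summable_mpow]
    by (rule suminf_cong) (simp add: c_def mpow_scaleR scaleR_conv_of_real[where 'a=complex])
  have "(X ** mexp (t *\<^sub>R X)) $ i $ j = (\<Sum>n. (X ** (mpow (t *\<^sub>R X) n /\<^sub>R fact n)) $ i $ j)"
    unfolding mexp_mpow bounded_linear.suminf[OF matrix_mult.bounded_linear_right summable_mpow]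
    by (rule bounded_linear.suminf[OF bl])
      (rule bounded_linear.summable[OF matrix_mult.bounded_linear_right summable_mpow])
  \<comment> \<open>\<open>diffs c n\<close> is \<open>(n + 1) * c (n + 1)\<close>. The factor
    cancels against \<open>fact (n + 1)\<close> and leaves the entry of
    \<open>mpow X (n + 1)\<close> over \<open>fact n\<close>.\<close>
  also have "\<dots> = (\<Sum>n. diffs c n * of_real t ^ n)"
    by (rule suminf_cong)
      (simp add: c_def diffs_def mpow_scaleR matrix_mult.scaleR_right mpow_Suc scaleR_conv_of_real[where 'a=complex]
        del: of_nat_Suc)
  finally have "(\<Sum>n. diffs c n * of_real t ^ n) = (X ** mexp (t *\<^sub>R X)) $ i $ j" ..
  with has_vector_derivative_real_field[OF deriv]
  show "((\<lambda>t. mexp (t *\<^sub>R X) $ i $ j) has_vector_derivative (X ** mexp (t *\<^sub>R X)) $ i $ j) (at t)"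
    by (simp add: entry o_def)
qed

text \<open>The product is constant along the one-parameter family, its derivative being zero, and
  at 0 it is the identity.\<close>

lemma mexp_minus_mult: "mexp (- X) ** mexp X = mat 1"
proof -
  let ?F = "\<lambda>t. mexp (t *\<^sub>R (- X)) ** mexp (t *\<^sub>R X)"
  have "(?F has_vector_derivative 0) (at t)" for t
  proof -
    \<comment> \<open>\<open>mexp_commute\<close> speaks of the scaled matrix. The scalar can be
      cancelled only if it is nonzero.\<close>
    have "X ** mexp (t *\<^sub>R (- X)) = mexp (t *\<^sub>R (- X)) ** X"
    proof (cases "t = 0")
      case False
      then show ?thesis
        using mexp_commute[of "t *\<^sub>R (- X)"]
        by (simp add: matrix_mult.scaleR_left matrix_mult.scaleR_right matrix_mult.minus_left matrix_mult.minus_right)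
    qed (simp add: mexp_0)
    then have "mexp (t *\<^sub>R (- X)) ** (X ** mexp (t *\<^sub>R X)) + (- X ** mexp (t *\<^sub>R (- X))) ** mexp (t *\<^sub>R X) = 0"
      by (simp add: matrix_mul_assoc matrix_mult.minus_left)
    with matrix_mult.has_vector_derivative[OF mexp_has_vector_derivative[of "- X"] mexp_has_vector_derivative[of X], of t]
    show ?thesis
      by (simp only:)
  qed
  then obtain c where "\<And>t. ?F t = c"
    using has_vector_derivative_zero_constant[of UNIV ?F] by auto
  then have "?F 1 = ?F 0"
    by (simp only:)
  then show ?thesis
    by (simp add: mexp_0)
qed

lemma mexp_mult_minus: "mexp X ** mexp (- X) = mat 1"
  using mexp_minus_mult[of "- X"] by simp

section \<open>Inverses, the compact group and curves in its orbit\<close>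

lemma matrix_inv_unique:
  fixes A :: "'a::semiring_1 ^ 'n ^ 'n"
  assumes "A ** B = mat 1" and "B ** A = mat 1"
  shows "matrix_inv A = B"
proof -
  \<comment> \<open>\<open>matrix_inv\<close> is a Hilbert choice; \<open>B\<close> witnesses that a
    two-sided inverse exists to be chosen.\<close>
  have inv: "A ** matrix_inv A = mat 1 \<and> matrix_inv A ** A = mat 1"
    unfolding matrix_inv_def by (rule someI[of _ B]) (use assms in simp)
  have "matrix_inv A = (B ** A) ** matrix_inv A"
    by (simp only: assms(2) matrix_mul_lid)
  also have "\<dots> = B ** (A ** matrix_inv A)"
    by (rule matrix_mul_assoc[symmetric])
  finally show ?thesis
    by (simp only: inv matrix_mul_rid)
qed

text \<open>The group is generated by factors appended on the right. Induction on \<open>a\<close>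
  carries the new left factor down to the identity, where the two sides agree.\<close>

lemma mexp_mult_compact_group:
  assumes "a \<in> compact_group gC" and "X \<in> compact_form gC"
  shows "mexp X ** a \<in> compact_group gC"
  using assms(1)
proof induction
  case one
  show ?case
    using compact_group.mult[OF compact_group.one assms(2)] by simp
next
  case (mult a Y)
  then show ?case
    unfolding matrix_mul_assoc by (intro compact_group.mult)
qed

lemma compact_group_invertible:
  "a \<in> compact_group gC \<Longrightarrow> \<exists>b. a ** b = mat 1 \<and> b ** a = mat 1"
proof (induction rule: compact_group.induct)
  case (mult a X)
  then obtain b where b: "a ** b = mat 1" "b ** a = mat 1"
    by blast
  have "(a ** mexp X) ** (mexp (- X) ** b) = a ** (mexp X ** mexp (- X)) ** b"
    "(mexp (- X) ** b) ** (a ** mexp X) = mexp (- X) ** (b ** a) ** mexp X"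
    by (simp_all only: matrix_mul_assoc)
  then show ?case
    using b by (intro exI[of _ "mexp (- X) ** b"]) (simp add: mexp_minus_mult mexp_mult_minus)
qed auto

text \<open>If \<open>p\<close> is the orbit point of \<open>a\<close>, its conjugate is the orbit
  point of \<open>mexp X ** a\<close>, whose inverse is computed explicitly.\<close>

lemma mexp_conj_orbit:
  assumes "p \<in> orbit gC \<rho>" and "X \<in> compact_form gC"
  shows "mexp X ** p ** mexp (- X) \<in> orbit gC \<rho>"
proof -
  obtain a where a: "a \<in> compact_group gC" "p = a ** \<rho> ** matrix_inv a"
    using assms(1) by (auto simp: orbit_def orbit_map_def)
  obtain b where b: "a ** b = mat 1" "b ** a = mat 1"
    using compact_group_invertible[OF a(1)] by blast
  have "(mexp X ** a) ** (b ** mexp (- X)) = mexp X ** (a ** b) ** mexp (- X)"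
    "(b ** mexp (- X)) ** (mexp X ** a) = b ** (mexp (- X) ** mexp X) ** a"
    by (simp_all only: matrix_mul_assoc)
  then have "matrix_inv (mexp X ** a) = b ** mexp (- X)"
    using b by (intro matrix_inv_unique) (simp_all add: mexp_minus_mult mexp_mult_minus)
  then have "mexp X ** p ** mexp (- X) = orbit_map \<rho> (mexp X ** a)"
    using a(2) matrix_inv_unique[OF b] by (simp add: orbit_map_def matrix_mul_assoc)
  then show ?thesis
    using mexp_mult_compact_group[OF a(1) assms(2)] by (auto simp: orbit_def)
qed

text \<open>Each classical algebra is the kernel of a real-linear map, and so is the set of
  anti-hermitian matrices. The use is that \<open>t *\<^sub>R X\<close> stays in the compact form,
  so that orbit curves can be built from it.\<close>

lemma subspace_compact_form:
  fixes gC :: "'n::finite cmat set"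
  assumes "classical_simple gC"
  shows "subspace (compact_form gC)"
proof -
  have "linear (trace :: 'n cmat \<Rightarrow> complex)"
    by (intro linearI) (simp_all add: trace_def sum.distrib scaleR_sum_right)
  then have "subspace {X :: 'n cmat. trace X = 0}"
    by (rule linear_subspace_kernel)
  moreover have "subspace (form_algebra B)" for B :: "'n cmat"
  proof -
    have "linear (transpose :: 'n cmat \<Rightarrow> 'n cmat)"
      by (intro linearI) (simp_all add: transpose_def vec_eq_iff)
    then have "linear (\<lambda>X. transpose X ** B + B ** X)"
      by (intro linearI) (simp_all add: linear_add linear_scale matrix_mult.add_left
          matrix_mult.add_right matrix_mult.scaleR_left matrix_mult.scaleR_right scaleR_add_right)
    then show ?thesis
      unfolding form_algebra_def by (rule linear_subspace_kernel)
  qed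
  ultimately have "subspace gC"
    using assms unfolding classical_simple_def by blast
  moreover have "subspace {X :: 'n cmat. dagger X + X = 0}"
    by (intro linear_subspace_kernel linearI) (simp_all add: dagger_def vec_eq_iff scaleR_add_right)
  moreover have "compact_form gC = gC \<inter> {X. dagger X + X = 0}"
    by (auto simp: compact_form_def eq_neg_iff_add_eq_0)
  ultimately show ?thesis
    by (simp add: subspace_inter)
qed

text \<open>For a tangent vector \<open>lbr X p\<close> the curve is conjugation of \<open>p\<close>
  by the one-parameter group of \<open>X\<close>; the product rule at 0 gives the
  commutator.\<close>

lemma orbit_curve:
  assumes gC: "subspace (compact_form gC)" and p: "p \<in> orbit gC \<rho>" and v: "v \<in> orbit_tangent gC p"
  obtains c where "c 0 = p" "range c \<subseteq> orbit gC \<rho>" "continuous_on UNIV c"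
    "(c has_vector_derivative v) (at 0)"
proof -
  obtain X where X: "X \<in> compact_form gC" "v = lbr X p"
    using v by (auto simp: orbit_tangent_def)
  define c where "c t = mexp (t *\<^sub>R X) ** p ** mexp (t *\<^sub>R (- X))" for t
  have deriv: "(c has_vector_derivative (mexp (t *\<^sub>R X) ** p ** (- X ** mexp (t *\<^sub>R (- X)))
      + X ** mexp (t *\<^sub>R X) ** p ** mexp (t *\<^sub>R (- X)))) (at t)" for t
    unfolding c_def
    by (intro matrix_mult.has_vector_derivative mexp_has_vector_derivative
        bounded_linear.has_vector_derivative[OF matrix_mult.bounded_linear_left])
  show ?thesis
  proof
    show "c 0 = p"
      by (simp add: c_def mexp_0)
    show "range c \<subseteq> orbit gC \<rho>"
      using mexp_conj_orbit[OF p subspace_scale[OF gC X(1)]] by (auto simp: c_def)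
    show "continuous_on UNIV c"
      using deriv by (metis continuous_at_imp_continuous_on has_vector_derivative_continuous)
    show "(c has_vector_derivative v) (at 0)"
      using deriv[of 0] by (simp add: mexp_0 X(2) lbr_def matrix_mult.minus_left matrix_mult.minus_right)
  qed
qed

section \<open>Differentials of smooth maps along curves\<close>

lemma smooth_map_on_differentiable:
  assumes "smooth_map_on S f" and "p \<in> S"
  shows "f differentiable (at p within S)"
proof -
  obtain W F where W: "open W" "p \<in> W" "\<forall>j. Ck_on j F W" "\<forall>q\<in>S \<inter> W. F q = f q"
    using assms unfolding smooth_map_on_def by blast
  have "Ck_on (Suc 0) F W"
    using W(3) ..
  then have "F differentiable (at p within S)"
    using W(2) by (simp add: differentiable_at_withinI)
  then obtain F' where "(F has_derivative F') (at p within S)"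
    by (auto simp: differentiable_def)
  \<comment> \<open>The local extension agrees with \<open>f\<close> on \<open>S\<close> only, which
    is enough for a derivative within \<open>S\<close>.\<close>
  moreover have "\<forall>\<^sub>F q in at p within S. F q = f q"
    unfolding eventually_at_topological using W(1,2,4) by blast
  ultimately have "(f has_derivative F') (at p within S)"
    by (rule has_derivative_transform_eventually) (use W(2,4) assms(2) in simp_all)
  then show ?thesis
    by (auto simp: differentiable_def)
qed

text \<open>A vector that is not tangent is annihilated by the differential, so the constant curve
  serves for it.\<close>

lemma differential_along_curve:
  assumes gC: "subspace (compact_form gC)" and U: "openin (top_of_set (orbit gC \<rho>)) U" and p: "p \<in> U"
  obtains c :: "real \<Rightarrow> 'n::finite cmat" where "c 0 = p" "\<forall>\<^sub>F t in at 0. c t \<in> U"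
    "\<And>f :: 'n cmat \<Rightarrow> complex. smooth_map_on U f \<Longrightarrow>
       ((\<lambda>t. f (c t)) has_vector_derivative differential (orbit_tangent gC) U f p v) (at 0)"
    "\<And>f :: 'n cmat \<Rightarrow> 'l::finite cmat. smooth_map_on U f \<Longrightarrow>
       ((\<lambda>t. f (c t)) has_vector_derivative differential (orbit_tangent gC) U f p v) (at 0)"
proof (cases "v \<in> orbit_tangent gC p")
  case True
  have po: "p \<in> orbit gC \<rho>"
    using openin_imp_subset[OF U] p by blast
  obtain c where c: "c 0 = p" "range c \<subseteq> orbit gC \<rho>" "continuous_on UNIV c"
    "(c has_vector_derivative v) (at 0)"
    using orbit_curve[OF gC po True] .
  obtain V where V: "open V" "U = orbit gC \<rho> \<inter> V"
    using U by (auto simp: openin_open)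
  \<comment> \<open>The curve is known to lie in \<open>U\<close> only for these parameters. As
    \<open>T\<close> is an open neighbourhood of 0, the chain rule within \<open>T\<close> yields a
    full derivative.\<close>
  define T where "T = c -` V"
  have cT: "c t \<in> U" if "t \<in> T" for t
    using c(2) V(2) that by (auto simp: T_def)
  have T: "open T" "0 \<in> T"
    using c(1,3) V p by (simp_all add: T_def open_vimage)
  \<comment> \<open>The target space is kept general: the same curve has to serve a complex function
    and a matrix function at once.\<close>
  have chain: "((\<lambda>t. f (c t)) has_vector_derivative differential (orbit_tangent gC) U f p v) (at 0)"
    if "smooth_map_on U f" for f :: "'n cmat \<Rightarrow> 'b::real_normed_vector"
  proof -
    have "(f has_derivative frechet_derivative f (at p within U)) (at p within U)"
      using smooth_map_on_differentiable[OF that p] unfolding frechet_derivative_works .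
    then have "(f has_derivative frechet_derivative f (at p within U)) (at (c 0) within c ` T)"
      unfolding c(1) by (rule has_derivative_subset) (use cT in blast)
    then have "((f \<circ> c) has_vector_derivative frechet_derivative f (at p within U) v) (at 0 within T)"
      by (rule vector_derivative_diff_chain_within[OF has_vector_derivative_at_within[OF c(4)]])
    then show ?thesis
      unfolding at_within_open[OF T(2,1)] o_def differential_def using True by simp
  qed
  show thesis
  proof (rule that)
    show "c 0 = p"
      by (rule c(1))
    show "\<forall>\<^sub>F t in at 0. c t \<in> U"
      unfolding eventually_at_topological using T cT by blast
  qed (rule chain, assumption)+
next
  case False
  then show thesis
    using p by (intro that[of "\<lambda>_. p"]) (simp_all add: differential_def)
qed

lemma subspace_orbit_tangent:
  assumes "subspace (compact_form gC)"
  shows "subspace (orbit_tangent gC p)"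
proof -
  have "linear (\<lambda>X. lbr X p)"
    by (intro linearI) (simp_all add: lbr_def matrix_mult.add_left matrix_mult.add_right
        matrix_mult.scaleR_left matrix_mult.scaleR_right scaleR_diff_right)
  then show ?thesis
    unfolding orbit_tangent_def using assms by (rule linear_subspace_image)
qed

text \<open>This admits dm itself as an eigenvector of the dual map. Additivity survives the cut-off
  to zero because the tangent vectors form a subspace.\<close>

lemma differential_covector:
  assumes gC: "subspace (compact_form gC)" and f: "smooth_map_on S f" and p: "p \<in> S"
  shows "differential (orbit_tangent gC) S f p \<in> covectors (orbit_tangent gC p)"
proof -
  have "linear (frechet_derivative f (at p within S))"
    using smooth_map_on_differentiable[OF f p] by (rule linear_frechet_derivative)
  then show ?thesis
    using subspace_add[OF subspace_orbit_tangent[OF gC]] subspace_scale[OF subspace_orbit_tangent[OF gC]]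
    by (simp add: covectors_def differential_def linear_add linear_scale)
qed

section \<open>The derivative of the determinant\<close>

text \<open>The directional derivative of the determinant at \<open>B\<close> along
  \<open>C\<close>, written as the product rule in the Leibniz formula. It makes sense over any
  commutative ring, in particular for polynomial entries.\<close>

definition detd :: "'a::comm_ring_1 ^ 'n ^ 'n \<Rightarrow> 'a ^ 'n ^ 'n \<Rightarrow> 'a" where
  "detd B C = (\<Sum>s | s permutes (UNIV::'n set). of_int (sign s) *
     (\<Sum>i\<in>UNIV. C $ i $ s i * (\<Prod>j\<in>UNIV - {i}. B $ j $ s j)))"

lemma detd_add: "detd B (C + D) = detd B C + detd B D"
  by (simp add: detd_def distrib_left distrib_right sum.distrib)

lemma detd_scale: "detd B (\<chi> i j. x * C $ i $ j) = x * detd B C"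
  by (simp add: detd_def sum_distrib_left algebra_simps)

text \<open>Exchanging the two sums collects, for each row, the Leibniz formula of \<open>B\<close>
  with that row taken from \<open>C\<close>.\<close>

lemma detd_rows: "detd B C = (\<Sum>i\<in>UNIV. det (\<chi> k. if k = i then C $ i else B $ k))"
proof -
  have "(\<Prod>k\<in>UNIV. (if k = i then C $ i else B $ k) $ s k)
      = C $ i $ s i * (\<Prod>j\<in>UNIV - {i}. B $ j $ s j)" for i and s :: "'b \<Rightarrow> 'b"
    by (subst prod.remove[of _ i]) auto
  then show ?thesis
    unfolding detd_def det_def sum_distrib_left by (subst sum.swap) simp
qed

text \<open>Row \<open>i\<close> of \<open>C ** B\<close> is a combination of the rows of
  \<open>B\<close>. All of them except row \<open>i\<close> itself produce a repeated row, so only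
  the diagonal entry of \<open>C\<close> survives.\<close>

lemma detd_mult_left: "detd B (C ** B) = trace C * det B"
proof -
  have "det (\<chi> k. if k = i then (C ** B) $ i else B $ k) = C $ i $ i * det B" for i
  proof -
    have row: "(C ** B) $ i = (\<Sum>l\<in>UNIV. C $ i $ l *s B $ l)"
      by (simp add: vec_eq_iff matrix_matrix_mult_def)
    have l: "det (\<chi> k. if k = i then B $ l else B $ k) = (if l = i then det B else 0)" for l
    proof (cases "l = i")
      case True
      have "(\<chi> k. if k = i then B $ l else B $ k) = B"
        using True by (simp add: vec_eq_iff)
      then show ?thesis
        using True by simp
    next
      case False
      then show ?thesis
        by (intro det_identical_rows[of i l, THEN trans]) (auto simp: row_def vec_eq_iff)
    qed
    show ?thesis
      unfolding row det_linear_row_sum[OF finite] det_row_mul l by (simp add: if_distrib cong: if_cong)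
  qed
  then show ?thesis
    by (simp add: detd_rows trace_def sum_distrib_right)
qed

text \<open>The term of a permutation for the transposes is that of its inverse for the originals,
  after reindexing rows by \<open>s\<close>; the sign is unchanged. This turns left multiplication
  into right multiplication.\<close>

lemma detd_transpose: "detd (transpose B) (transpose C) = detd B C"
proof -
  let ?t = "\<lambda>B C s. of_int (sign s) *
     (\<Sum>i\<in>UNIV. C $ i $ s i * (\<Prod>j\<in>UNIV - {i}. B $ j $ s j))"
  have "?t (transpose B) (transpose C) (inv s) = ?t B C s" if s: "s permutes UNIV" for s
  proof -
    have b: "bij s"
      using s by (rule permutes_bij)
    have inv: "inv s (s i) = i" for i
      using s by (simp add: permutes_inverses)
    have "(\<Sum>i\<in>UNIV. C $ inv s i $ i * (\<Prod>j\<in>UNIV - {i}. B $ inv s j $ j))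
       = (\<Sum>i\<in>UNIV. C $ inv s (s i) $ s i * (\<Prod>j\<in>UNIV - {s i}. B $ inv s j $ j))"
      using sum.reindex_bij_betw[OF b, of "\<lambda>i. C $ inv s i $ i * (\<Prod>j\<in>UNIV - {i}. B $ inv s j $ j)"]
      by simp
    moreover have "(\<Prod>j\<in>UNIV - {s i}. B $ inv s j $ j) = (\<Prod>j\<in>UNIV - {i}. B $ j $ s j)" for i
    proof -
      have "bij_betw s (UNIV - {i}) (UNIV - {s i})"
        using b by (simp add: bij_betw_DiffI)
      from prod.reindex_bij_betw[OF this, of "\<lambda>j. B $ inv s j $ j"] show ?thesis
        by (simp add: inv)
    qed
    ultimately show ?thesis
      using sign_inverse[OF permutes_imp_permutation[OF finite s]] by (simp add: transpose_def inv)
  qed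
  then have "(\<Sum>s | s permutes (UNIV::'b set). ?t B C s)
      = (\<Sum>s | s permutes (UNIV::'b set). ?t (transpose B) (transpose C) (inv s))"
    by simp
  also have "\<dots> = (\<Sum>s | s permutes (UNIV::'b set). ?t (transpose B) (transpose C) s)"
    by (rule sum_permutations_inverse[symmetric])
  finally show ?thesis
    by (simp only: detd_def)
qed

lemma detd_mult_right: "detd B (B ** C) = trace C * det B"
proof -
  have "detd B (B ** C) = detd (transpose B) (transpose C ** transpose B)"
    using detd_transpose[of B "B ** C"] by (simp add: matrix_transpose_mul)
  also have "\<dots> = trace C * det B"
    unfolding detd_mult_left det_transpose by (simp add: trace_def transpose_def)
  finally show ?thesis .
qed

section \<open>Derivatives of families of polynomials\<close>

text \<open>Coefficientwise derivative at 0. The common degree bound turns evaluation into a finite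
  sum of fixed length, which can be differentiated termwise.\<close>

definition poly_has_derivative :: "(real \<Rightarrow> complex poly) \<Rightarrow> complex poly \<Rightarrow> bool" where
  "poly_has_derivative P D \<longleftrightarrow> (\<exists>N. degree D \<le> N \<and> (\<forall>t. degree (P t) \<le> N)) \<and>
     (\<forall>i. ((\<lambda>t. coeff (P t) i) has_vector_derivative coeff D i) (at 0))"

lemma poly_has_derivative_const: "poly_has_derivative (\<lambda>t. p) 0"
  by (auto simp: poly_has_derivative_def)

lemma poly_has_derivative_pCons:
  "(f has_vector_derivative D) (at 0) \<Longrightarrow> poly_has_derivative (\<lambda>t. [:f t:]) [:D:]"
  unfolding poly_has_derivative_def by (intro conjI exI[of _ 0] allI) (auto simp: coeff_pCons split: nat.split)

lemma poly_has_derivative_add: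
  assumes "poly_has_derivative P D" and "poly_has_derivative Q E"
  shows "poly_has_derivative (\<lambda>t. P t + Q t) (D + E)"
proof -
  obtain N N' where "degree D \<le> N" "\<And>t. degree (P t) \<le> N" "degree E \<le> N'" "\<And>t. degree (Q t) \<le> N'"
    using assms by (auto simp: poly_has_derivative_def)
  then have "degree (D + E) \<le> max N N'" "\<And>t. degree (P t + Q t) \<le> max N N'"
    by (meson degree_add_le max.coboundedI1 max.coboundedI2)+
  then show ?thesis
    using assms unfolding poly_has_derivative_def by (auto intro!: derivative_intros)
qed

lemma poly_has_derivative_mult:
  assumes "poly_has_derivative P D" and "poly_has_derivative Q E"
  shows "poly_has_derivative (\<lambda>t. P t * Q t) (P 0 * E + D * Q 0)"
proof -
  obtain N N' where N: "degree D \<le> N" "\<And>t. degree (P t) \<le> N" "degree E \<le> N'" "\<And>t. degree (Q t) \<le> N'"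
    using assms by (auto simp: poly_has_derivative_def)
  then have le: "degree (A * B) \<le> N + N'" if "degree A \<le> N" "degree B \<le> N'" for A B :: "complex poly"
    using that by (meson add_mono degree_mult_le order_trans)
  have "degree (P 0 * E + D * Q 0) \<le> N + N'" "\<And>t. degree (P t * Q t) \<le> N + N'"
    using N by (auto intro!: degree_add_le le)
  moreover have "((\<lambda>t. coeff (P t * Q t) i) has_vector_derivative coeff (P 0 * E + D * Q 0) i) (at 0)" for i
    unfolding coeff_mult coeff_add sum.distrib[symmetric]
    using assms by (intro has_vector_derivative_sum has_vector_derivative_mult)
      (auto simp: poly_has_derivative_def)
  ultimately show ?thesis
    unfolding poly_has_derivative_def by blast
qed

lemma poly_has_derivative_minus:
  "poly_has_derivative P D \<Longrightarrow> poly_has_derivative (\<lambda>t. - P t) (- D)"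
  unfolding poly_has_derivative_def by (auto intro!: derivative_intros)

lemma poly_has_derivative_sum:
  "finite I \<Longrightarrow> (\<And>i. i \<in> I \<Longrightarrow> poly_has_derivative (P i) (D i)) \<Longrightarrow>
    poly_has_derivative (\<lambda>t. \<Sum>i\<in>I. P i t) (\<Sum>i\<in>I. D i)"
  by (induction I rule: finite_induct) (auto intro: poly_has_derivative_add poly_has_derivative_const)

lemma poly_has_derivative_prod:
  "finite I \<Longrightarrow> (\<And>i. i \<in> I \<Longrightarrow> poly_has_derivative (P i) (D i)) \<Longrightarrow>
    poly_has_derivative (\<lambda>t. \<Prod>i\<in>I. P i t) (\<Sum>i\<in>I. D i * (\<Prod>j\<in>I - {i}. P j 0))"
proof (induction I rule: finite_induct)
  case (insert a I)
  have "(\<Prod>j\<in>insert a I - {i}. P j 0) = P a 0 * (\<Prod>j\<in>I - {i}. P j 0)" if "i \<in> I" for i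
  proof -
    have "insert a I - {i} = insert a (I - {i})"
      using that insert.hyps by auto
    then show ?thesis
      using insert.hyps by simp
  qed
  then have "(\<Sum>i\<in>I. D i * (\<Prod>j\<in>insert a I - {i}. P j 0))
      = P a 0 * (\<Sum>i\<in>I. D i * (\<Prod>j\<in>I - {i}. P j 0))"
    unfolding sum_distrib_left by (intro sum.cong) (simp_all add: mult.left_commute)
  moreover have "insert a I - {a} = I"
    using insert.hyps by auto
  ultimately have eq: "(\<Sum>i\<in>insert a I. D i * (\<Prod>j\<in>insert a I - {i}. P j 0))
      = P a 0 * (\<Sum>i\<in>I. D i * (\<Prod>j\<in>I - {i}. P j 0)) + D a * (\<Prod>j\<in>I. P j 0)"
    unfolding sum.insert[OF insert.hyps] by (simp only: add.commute)
  show ?case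
    unfolding eq prod.insert[OF insert.hyps] using insert.prems
    by (intro poly_has_derivative_mult insert.IH) auto
qed (simp add: poly_has_derivative_const)

text \<open>Justifies \<open>detd\<close> as a derivative: the product rule is applied to every term
  of the Leibniz sum.\<close>

lemma poly_has_derivative_det:
  assumes "\<And>i j. poly_has_derivative (\<lambda>t. B t $ i $ j) (D $ i $ j)"
  shows "poly_has_derivative (\<lambda>t. det (B t)) (detd (B 0) D)"
proof -
  have "poly_has_derivative (\<lambda>t. of_int (sign s) * (\<Prod>i\<in>UNIV. B t $ i $ s i))
     (of_int (sign s) * (\<Sum>i\<in>UNIV. D $ i $ s i * (\<Prod>j\<in>UNIV - {i}. B 0 $ j $ s j)))" for s
    using poly_has_derivative_mult[OF poly_has_derivative_const poly_has_derivative_prod[OF finite assms]] by simp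
  then show ?thesis
    unfolding det_def detd_def by (intro poly_has_derivative_sum) (auto simp: finite_permutations)
qed

lemma poly_has_derivative_pderiv:
  assumes "poly_has_derivative P D"
  shows "poly_has_derivative (\<lambda>t. pderiv (P t)) (pderiv D)"
proof -
  obtain N where "degree D \<le> N" "\<And>t. degree (P t) \<le> N"
    using assms by (auto simp: poly_has_derivative_def)
  then have "degree (pderiv D) \<le> N" "\<And>t. degree (pderiv (P t)) \<le> N"
    by (auto simp: degree_pderiv intro: le_trans[OF diff_le_self])
  moreover have "((\<lambda>t. of_nat (Suc i) * coeff (P t) (Suc i)) has_vector_derivative of_nat (Suc i) * coeff D (Suc i)) (at 0)" for i
    using assms by (intro has_vector_derivative_mult_right) (auto simp: poly_has_derivative_def)
  ultimately show ?thesis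
    unfolding poly_has_derivative_def coeff_pderiv by blast
qed

lemma poly_has_derivative_funpow_pderiv:
  "poly_has_derivative P D \<Longrightarrow> poly_has_derivative (\<lambda>t. (pderiv ^^ j) (P t)) ((pderiv ^^ j) D)"
proof (induction j)
  case (Suc j)
  then show ?case
    using poly_has_derivative_pderiv[of "\<lambda>t. (pderiv ^^ j) (P t)"] by simp
qed simp

text \<open>Chain rule for evaluation at a moving point: one contribution from the coefficients, one
  from the point.\<close>

lemma poly_has_derivative_poly:
  assumes "poly_has_derivative P D" and m: "(m has_vector_derivative m') (at 0)"
  shows "((\<lambda>t. poly (P t) (m t)) has_vector_derivative
    poly (D + smult m' (pderiv (P 0))) (m 0)) (at 0)"
proof -
  obtain N where N: "degree D \<le> N" "\<And>t. degree (P t) \<le> N"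
    using assms by (auto simp: poly_has_derivative_def)
  have eq: "poly p x = (\<Sum>i\<le>N. coeff p i * x ^ i)" if "degree p \<le> N" for p :: "complex poly" and x
    using arg_cong[OF poly_as_sum_of_monoms'[OF that], of "\<lambda>p. poly p x"] by (simp add: poly_sum poly_monom)
  \<comment> \<open>For \<open>i = 0\<close> the truncated exponent \<open>i - 1\<close> is
    harmless, since the factor \<open>of_nat i\<close> vanishes.\<close>
  have "((\<lambda>t. m t ^ i) has_vector_derivative of_nat i * m 0 ^ (i - 1) * m') (at 0)" for i
  proof -
    have "((\<lambda>z. z ^ i) has_field_derivative of_nat i * m 0 ^ (i - 1)) (at (m 0))"
      by (auto intro!: derivative_eq_intros)
    from field_vector_diff_chain_at[OF m this] show ?thesis
      by (simp add: o_def mult_ac)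
  qed
  then have "((\<lambda>t. \<Sum>i\<le>N. coeff (P t) i * m t ^ i) has_vector_derivative
     (\<Sum>i\<le>N. coeff (P 0) i * (of_nat i * m 0 ^ (i - 1) * m') + coeff D i * m 0 ^ i)) (at 0)"
    using assms(1) by (intro has_vector_derivative_sum has_vector_derivative_mult)
      (auto simp: poly_has_derivative_def)
  moreover have "(\<Sum>i\<le>N. coeff (P 0) i * (of_nat i * m 0 ^ (i - 1) * m')) = m' * poly (pderiv (P 0)) (m 0)"
  proof -
    have "pderiv (P 0) = pderiv (\<Sum>i\<le>N. monom (coeff (P 0) i) i)"
      using N(2)[of 0] by (simp only: poly_as_sum_of_monoms')
    also have "\<dots> = (\<Sum>i\<le>N. monom (of_nat i * coeff (P 0) i) (i - 1))"
      using higher_pderiv_sum[of 1 "\<lambda>i. monom (coeff (P 0) i) i" "{..N}"] by (simp add: pderiv_monom)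
    finally show ?thesis
      by (simp add: poly_sum poly_monom sum_distrib_left mult_ac)
  qed
  ultimately show ?thesis
    using N by (simp add: eq sum.distrib add.commute)
qed

section \<open>Root multiplicity and higher derivatives\<close>

lemma dvd_pderiv:
  fixes p :: "'a::idom poly"
  assumes "[:- a, 1:] ^ Suc n dvd p"
  shows "[:- a, 1:] ^ n dvd pderiv p"
proof -
  obtain q where "p = [:- a, 1:] ^ Suc n * q"
    using assms by (auto elim: dvdE)
  moreover have "pderiv [:- a, 1:] = 1"
    by (simp add: pderiv_pCons)
  ultimately have "pderiv p = [:- a, 1:] ^ n * ([:- a, 1:] * pderiv q + smult (of_nat (Suc n)) q)"
    by (simp only: pderiv_mult pderiv_power_Suc) (simp only: power_Suc distrib_left mult_smult_left
        mult_smult_right mult_ac mult_1_left mult_1_right)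
  then show ?thesis
    by simp
qed

text \<open>Replaces divisibility by a power of a moving linear factor by finitely many equations,
  which can be differentiated in a parameter.\<close>

lemma power_dvd_iff_pderiv:
  fixes p :: "'a::field_char_0 poly"
  shows "[:- a, 1:] ^ d dvd p \<longleftrightarrow> (\<forall>j<d. poly ((pderiv ^^ j) p) a = 0)"
proof (induction d arbitrary: p)
  case (Suc d)
  have "[:- a, 1:] ^ Suc d dvd p \<longleftrightarrow> poly p a = 0 \<and> [:- a, 1:] ^ d dvd pderiv p"
  proof safe
    assume *: "[:- a, 1:] ^ Suc d dvd p"
    then show "[:- a, 1:] ^ d dvd pderiv p"
      by (rule dvd_pderiv)
    show "poly p a = 0"
      using * by (metis dvd_mult_left poly_eq_0_iff_dvd power_Suc)
  next
    assume *: "poly p a = 0" "[:- a, 1:] ^ d dvd pderiv p"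
    show "[:- a, 1:] ^ Suc d dvd p"
    \<comment> \<open>\<open>order_pderiv\<close> needs a nonzero derivative. If the derivative is
      zero, \<open>p\<close> is constant and, having a root, zero.\<close>
    proof (cases "p = 0 \<or> pderiv p = 0")
      case True
      then show ?thesis
        using *(1) by (auto dest!: pderiv_iszero)
    next
      case False
      then show ?thesis
        using * order_pderiv[of p a] by (simp only: order_divides) auto
    qed
  qed
  also have "\<dots> \<longleftrightarrow> (\<forall>j<Suc d. poly ((pderiv ^^ j) p) a = 0)"
    unfolding Suc.IH All_less_Suc2 by (simp add: funpow_swap1[of pderiv])
  finally show ?case .
qed simp

text \<open>The first \<open>d\<close> derivatives of \<open>P t\<close> vanish at
  \<open>m t\<close> for all small \<open>t\<close>. Differentiating these equations in
  \<open>t\<close> gives the vanishing of the same derivatives of the chain-rule expression.\<close>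

lemma dvd_derivative_of_root_power:
  assumes P: "poly_has_derivative P D" and m: "(m has_vector_derivative m') (at 0)"
    and dvd: "\<forall>\<^sub>F t in at 0. [:- m t, 1:] ^ d dvd P t" "[:- m 0, 1:] ^ d dvd P 0"
  shows "[:- m 0, 1:] ^ d dvd D + smult m' (pderiv (P 0))"
  unfolding power_dvd_iff_pderiv
proof safe
  fix j assume j: "j < d"
  let ?g = "\<lambda>t. poly ((pderiv ^^ j) (P t)) (m t)"
  have "\<forall>\<^sub>F t in at 0. ?g t = 0" "?g 0 = 0"
    using dvd j by (auto simp: power_dvd_iff_pderiv elim!: eventually_mono)
  \<comment> \<open>The filter \<open>at 0\<close> omits the point 0, so the value there enters
    separately.\<close>
  then have "(?g has_vector_derivative 0) (at 0)"
    by (subst has_vector_derivative_cong_ev[where g="\<lambda>_. 0"])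
      (auto elim!: eventually_mono simp: eventually_at_filter)
  with poly_has_derivative_poly[OF poly_has_derivative_funpow_pderiv[OF P] m]
  have "poly ((pderiv ^^ j) D + smult m' (pderiv ((pderiv ^^ j) (P 0)))) (m 0) = 0"
    by (rule vector_derivative_unique_at)
  then show "poly ((pderiv ^^ j) (D + smult m' (pderiv (P 0)))) (m 0) = 0"
    by (simp only: higher_pderiv_add higher_pderiv_smult funpow_swap1[of pderiv])
qed

section \<open>Derivatives of eigenvalues\<close>

definition const_mat :: "'a::comm_ring_1 ^ 'n ^ 'n \<Rightarrow> 'a poly ^ 'n ^ 'n" where
  "const_mat A = (\<chi> i j. [:A $ i $ j:])"

lemma charpoly_const_mat: "charpoly A = det (mat [:0, 1:] - const_mat A)"
  unfolding charpoly_def const_mat_def by (rule arg_cong[where f=det]) (auto simp: vec_eq_iff mat_def)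

lemma const_mat_add: "const_mat (A + B) = const_mat A + const_mat B"
  by (simp add: const_mat_def vec_eq_iff)

lemma const_mat_mult: "const_mat (A ** B) = const_mat A ** const_mat B"
proof -
  have "[:a + b:] = [:a:] + [:b:]" for a b :: 'a
    by simp
  then have "[:sum f S:] = (\<Sum>x\<in>S. [:f x:])" for f :: "'b \<Rightarrow> 'a" and S
    by (induction S rule: infinite_finite_induct) (auto simp del: add_pCons)
  then show ?thesis
    by (simp add: const_mat_def vec_eq_iff matrix_matrix_mult_def mult.commute)
qed

lemma const_mat_cscale: "const_mat (c *\<^sub>C A) = (\<chi> i j. [:c:] * const_mat A $ i $ j)"
  by (simp add: const_mat_def cscale_def vec_eq_iff)

lemma mult_if: "(if b then x else 0) * y = (if b then x * y else (0::'a::mult_zero))"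
  "y * (if b then x else 0) = (if b then y * x else 0)"
  by simp_all

lemma poly_det: "poly (det B) x = det (\<chi> i j. poly (B $ i $ j) x)"
  by (simp add: det_def poly_sum poly_prod)

lemma poly_charpoly: "poly (charpoly A) x = det (mat x - A)"
  unfolding charpoly_def poly_det by (rule arg_cong[where f=det]) (auto simp: vec_eq_iff mat_def)

text \<open>\<open>Q\<close> is the reversed polynomial, the determinant of 1 - x A. Its value at 0
  is 1, so it is nonzero at some \<open>x\<close> other than 0, and then the characteristic
  polynomial is nonzero at \<open>1 / x\<close>.\<close>

lemma charpoly_nonzero: "charpoly A \<noteq> 0"
proof -
  define Q where "Q = det (\<chi> i j. [:mat 1 $ i $ j, - A $ i $ j:])"
  have Q: "poly Q x = det (mat 1 - mat x ** A)" for x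
    unfolding Q_def poly_det by (rule arg_cong[where f=det])
      (auto simp: vec_eq_iff matrix_matrix_mult_def mat_def mult_if)
  have "poly Q 0 = 1"
    unfolding Q_def poly_det by (subst det_I[symmetric], rule arg_cong[where f=det]) (simp add: vec_eq_iff)
  then have "finite {x. poly Q x = 0}"
    by (intro poly_roots_finite) auto
  then have "finite (insert 0 {x. poly Q x = 0})"
    by simp
  from ex_new_if_finite[OF infinite_UNIV_char_0 this]
  obtain x where x: "x \<noteq> 0" "poly Q x \<noteq> 0"
    by auto
  have "mat 1 - mat x ** A = mat x ** (mat (1 / x) - A)"
    using x(1) by (auto simp: vec_eq_iff matrix_matrix_mult_def mat_def right_diff_distrib sum_subtractf mult_if)
  then have "poly (charpoly A) (1 / x) \<noteq> 0"
    using x(2) by (auto simp: Q poly_charpoly det_mul)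
  then show ?thesis
    by auto
qed

text \<open>An eigenvector lies in the kernel of \<open>mat c - A\<close>, so \<open>c\<close> is a
  root. Positive order also uses that the polynomial is nonzero.\<close>

lemma eigenvalue_alg_multiplicity_pos:
  assumes "eigenvalue A c"
  shows "alg_multiplicity A c > 0"
proof -
  obtain v where v: "v \<noteq> 0" "A *v v = c *s v"
    using assms by (auto simp: eigenvalue_def)
  have "(mat c - A) *v v = 0"
  proof -
    have "mat c *v v = c *s v"
      by (auto simp: vec_eq_iff matrix_vector_mult_def mat_def mult_if)
    then show ?thesis
      using v(2) by (simp add: matrix_vector_mult_diff_rdistrib)
  qed
  then have "det (mat c - A) = 0"
    using v(1) by (metis invertible_det_nz invertible_def matrix_left_invertible_ker)
  then show ?thesis
    using charpoly_nonzero[of A] by (simp add: alg_multiplicity_def order_gt_0_iff poly_charpoly)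
qed

section \<open>Variation of the characteristic polynomial and of its root\<close>

lemma charpoly_has_derivative:
  assumes "(A has_vector_derivative A') (at 0)"
  shows "poly_has_derivative (\<lambda>t. charpoly (A t))
    (detd (mat [:0, 1:] - const_mat (A 0)) (- const_mat A'))"
  unfolding charpoly_const_mat
proof (rule poly_has_derivative_det)
  fix i j
  have "((\<lambda>t. A t $ i $ j) has_vector_derivative A' $ i $ j) (at 0)"
    using bounded_linear.has_vector_derivative[OF bounded_linear_vec_nth
        bounded_linear.has_vector_derivative[OF bounded_linear_vec_nth assms]] .
  from poly_has_derivative_add[OF poly_has_derivative_const
      poly_has_derivative_minus[OF poly_has_derivative_pCons[OF this]]]
  show "poly_has_derivative (\<lambda>t. (mat [:0, 1:] - const_mat (A t)) $ i $ j)
      ((- const_mat A') $ i $ j)"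
    by (simp add: const_mat_def diff_conv_add_uminus del: add_uminus_conv_diff minus_pCons)
qed

text \<open>Substituting x - B for A turns the outer terms of \<open>A2\<close> into
  \<open>M ** B\<close> and \<open>B ** P\<close>, each contributing a trace times the determinant.
  What remains is x times the sum of \<open>P\<close> and \<open>M\<close>, a multiple of
  \<open>A1\<close> by assumption.\<close>

lemma detd_charmat_relation:
  fixes A :: "'n::finite cmat"
  assumes "Bp + Bm = k *\<^sub>C A1" and "A2 = Bm ** A + A ** Bp + r *\<^sub>C A1"
  defines "B \<equiv> mat [:0, 1:] - const_mat A"
  shows "\<exists>s. detd B (- const_mat A2) = [:r, k:] * detd B (- const_mat A1) + s * charpoly A"
proof -
  define Z where "Z = - const_mat A1"
  define P where "P = const_mat Bp"
  define M where "M = const_mat Bm"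
  have A: "const_mat A = mat [:0, 1:] - B"
    by (simp add: B_def)
  have sc: "mat x ** C = (\<chi> i j. x * C $ i $ j)" "C ** mat x = (\<chi> i j. x * C $ i $ j)"
    for x and C :: "complex poly ^ 'n ^ 'n"
    by (simp_all add: vec_eq_iff matrix_matrix_mult_def mat_def mult_if mult.commute)
  have ml: "C ** (X - Y) = C ** X - C ** Y" "(X - Y) ** C = X ** C - Y ** C" for C X Y :: "complex poly ^ 'n ^ 'n"
    by (simp_all add: vec_eq_iff matrix_matrix_mult_def algebra_simps sum_subtractf)
  have "const_mat (Bp + Bm) = const_mat (k *\<^sub>C A1)"
    using assms by simp
  then have PM: "P $ i $ j + M $ i $ j = - [:k:] * Z $ i $ j" for i j
    by (simp add: P_def M_def Z_def const_mat_add const_mat_cscale vec_eq_iff)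
  have "- const_mat A2 = - (M ** (mat [:0, 1:] - B)) - (mat [:0, 1:] - B) ** P + (\<chi> i j. [:r:] * Z $ i $ j)"
    unfolding assms(2) const_mat_add const_mat_mult const_mat_cscale A P_def M_def
    by (simp add: Z_def vec_eq_iff)
  also have "\<dots> = M ** B + B ** P + (\<chi> i j. [:r, k:] * Z $ i $ j)"
  proof -
    have rk: "[:r, k:] = [:r:] + [:0, 1:] * [:k:]"
      by simp
    \<comment> \<open>The identity for a single entry: \<open>m\<close>, \<open>p\<close>,
      \<open>z\<close> are entries of \<open>M\<close>, \<open>P\<close>, \<open>Z\<close>, while
      \<open>mb\<close> and \<open>bp\<close> are those of \<open>M ** B\<close> and
      \<open>B ** P\<close>.\<close>
    have "- (x * m - mb) - (x * p - bp) + r0 * z = mb + bp + (r0 + x * k0) * z"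
      if "p + m = - k0 * z" for x m mb p bp r0 z k0 :: "complex poly"
      using arg_cong[OF that, of "(*) x"] by (simp add: algebra_simps)
    from this[OF PM] show ?thesis
      unfolding ml sc rk by (simp only: vec_eq_iff vector_add_component vector_minus_component
        vector_uminus_component vec_lambda_beta simp_thms)
  qed
  finally have "detd B (- const_mat A2) = trace M * det B + trace P * det B + [:r, k:] * detd B Z"
    by (simp only: detd_add detd_mult_left detd_mult_right detd_scale)
  then show ?thesis
    unfolding Z_def charpoly_const_mat[of A] B_def[symmetric]
    by (intro exI[of _ "trace M + trace P"]) (simp add: algebra_simps)
qed

text \<open>The core of the argument, free of the orbit. The two families pass through the same
  matrix \<open>A\<close>; they stand for the directions v and N v.\<close>

lemma eigenvalue_derivative_relation:
  fixes A1 A2 :: "real \<Rightarrow> 'l::finite cmat" and m1 m2 :: "real \<Rightarrow> complex"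
  assumes A: "A1 0 = A" "A2 0 = A" and m: "m1 0 = c" "m2 0 = c" "eigenvalue A c"
    and dA: "(A1 has_vector_derivative A1') (at 0)" "(A2 has_vector_derivative A2') (at 0)"
    and dm: "(m1 has_vector_derivative m1') (at 0)" "(m2 has_vector_derivative m2') (at 0)"
    and mult: "\<forall>\<^sub>F t in at 0. alg_multiplicity (A1 t) (m1 t) = alg_multiplicity A c"
      "\<forall>\<^sub>F t in at 0. alg_multiplicity (A2 t) (m2 t) = alg_multiplicity A c"
    and rel: "Bp + Bm = k *\<^sub>C A1'" "A2' = Bm ** A + A ** Bp + r *\<^sub>C A1'"
  shows "m2' = (c * k + r) * m1'"
proof -
  define d where "d = alg_multiplicity A c"
  define chi where "chi = charpoly A"
  define D where "D A' = detd (mat [:0, 1:] - const_mat A) (- const_mat A')" for A'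
  obtain s where s: "D A2' = [:r, k:] * D A1' + s * chi"
    using detd_charmat_relation[OF rel] unfolding D_def chi_def by blast
  have dvdI: "[:- x, 1:] ^ d dvd charpoly X" if "alg_multiplicity X x = d" for x and X :: "'l cmat"
    using that order_1[of x "charpoly X"] by (simp add: alg_multiplicity_def)
  have dvd0: "[:- c, 1:] ^ d dvd chi"
    unfolding chi_def by (rule dvdI) (simp add: d_def)
  have "[:- c, 1:] ^ d dvd D A1' + smult m1' (pderiv chi)"
    using dvd_derivative_of_root_power[OF charpoly_has_derivative[OF dA(1)] dm(1), of d] dvd0
      eventually_mono[OF mult(1)[folded d_def] dvdI]
    unfolding A m D_def chi_def by blast
  moreover have "[:- c, 1:] ^ d dvd D A2' + smult m2' (pderiv chi)"
    using dvd_derivative_of_root_power[OF charpoly_has_derivative[OF dA(2)] dm(2), of d] dvd0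
      eventually_mono[OF mult(2)[folded d_def] dvdI]
    unfolding A m D_def chi_def by blast
  \<comment> \<open>The combination is chosen so that the relation \<open>s\<close> cancels
    \<open>D A1'\<close> and \<open>D A2'\<close>, leaving a multiple of
    \<open>pderiv chi\<close>.\<close>
  ultimately have "[:- c, 1:] ^ d dvd
      (D A2' + smult m2' (pderiv chi)) - [:r, k:] * (D A1' + smult m1' (pderiv chi)) - s * chi"
    using dvd0 by (intro dvd_diff dvd_mult)
  also have "\<dots> = ([:m2':] - smult m1' [:r, k:]) * pderiv chi"
    unfolding s by (simp add: algebra_simps smult_diff_left)
  finally have dvd: "[:- c, 1:] ^ d dvd ([:m2':] - smult m1' [:r, k:]) * pderiv chi" .
  have ord: "order c chi = d" "d > 0"
    using eigenvalue_alg_multiplicity_pos[OF m(3)] by (simp_all add: d_def chi_def alg_multiplicity_def)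
  have nz: "chi \<noteq> 0"
    by (simp add: chi_def charpoly_nonzero)
  have root: "poly chi c = 0"
    using ord by (simp add: order_root)
  \<comment> \<open>The derivative has order only \<open>d - 1\<close> at \<open>c\<close>, so one
    factor must come from \<open>L\<close>.\<close>
  have ord': "order c chi = Suc (order c (pderiv chi))"
    using nz root by (rule order_pderiv)
  have pnz: "pderiv chi \<noteq> 0"
    using nz root by (auto dest!: pderiv_iszero)
  define L where "L = [:m2':] - smult m1' [:r, k:]"
  have "poly L c = 0"
  \<comment> \<open>The order of a product is additive only for a nonzero product; for
    \<open>L = 0\<close> the claim is immediate.\<close>
  proof (cases "L = 0")
    case False
    then have "L * pderiv chi \<noteq> 0"
      using pnz by simp
    then have "d \<le> order c L + order c (pderiv chi)"
      using dvd order_divides[of c d "L * pderiv chi"] order_mult[of L "pderiv chi" c]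
      unfolding L_def[symmetric] by simp
    then have "order c L \<noteq> 0"
      using ord ord' by linarith
    then show ?thesis
      by (simp add: order_root)
  qed simp
  then show ?thesis
    by (simp add: L_def algebra_simps)
qed


theorem proposition6p2:
  fixes gC t :: "'n::finite cmat set"
    and \<Delta> :: "('n functional) set" and \<phi> :: "'n functional" and \<rho> :: "'n cmat"
    and J :: "'n cmat \<Rightarrow> 'n cmat"
    and \<pi>G \<pi>0 \<pi>kks :: "'n cmat \<Rightarrow> 'n cmat bivec"
    and U :: "'n cmat set"
    and M :: "'n cmat \<Rightarrow> 'l::finite cmat" and m :: "'n cmat \<Rightarrow> complex"
    and dMplus dMminus :: "'n cmat \<Rightarrow> 'n cmat \<Rightarrow> 'l cmat"
    and k r :: complex and d :: nat
  assumes "classical_simple gC"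
    and "cartan gC t"
    and "simple_roots gC t \<Delta>"
    and "noncompact_simple_root gC t \<Delta> \<phi>"
    and "\<rho> \<in> center (h_subalgebra gC t \<Delta> \<phi>)" and "\<phi> \<rho> = \<i>"
    and "kks_bivector gC \<rho> \<pi>kks"
    and "J_map gC t \<Delta> J"
    and "standard_poisson_lie gC J \<pi>G"
    and "bruhat_poisson gC \<rho> \<pi>G \<pi>0"
    and "openin (top_of_set (orbit gC \<rho>)) U"
    and "smooth_map_on U M"
    and "smooth_map_on U m"
    and "\<exists>p\<in>U. \<exists>q\<in>U. m p \<noteq> m q"
    and "\<And>p. p \<in> U \<Longrightarrow> eigenvalue (M p) (m p)"
    and "\<And>p. p \<in> U \<Longrightarrow> alg_multiplicity (M p) (m p) = d"
    and "smooth_one_form_on (orbit_tangent gC) U dMplus"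
    and "smooth_one_form_on (orbit_tangent gC) U dMminus"
    and "\<And>p v. p \<in> U \<Longrightarrow> v \<in> orbit_tangent gC p \<Longrightarrow>
           dMplus p v + dMminus p v = k *\<^sub>C differential (orbit_tangent gC) U M p v"
    and "\<And>p v. p \<in> U \<Longrightarrow> v \<in> orbit_tangent gC p \<Longrightarrow>
           nijenhuis_dual gC \<pi>0 \<pi>kks p (differential (orbit_tangent gC) U M p) v
             = dMminus p v ** M p + M p ** dMplus p v
               + r *\<^sub>C differential (orbit_tangent gC) U M p v"
  shows "(\<forall>p\<in>U. \<forall>v\<in>orbit_tangent gC p.
            nijenhuis_dual gC \<pi>0 \<pi>kks p (differential (orbit_tangent gC) U m p) v
              = (m p * k + r) * differential (orbit_tangent gC) U m p v)
       \<and> (\<forall>p\<in>U. differential (orbit_tangent gC) U m p \<noteq> (\<lambda>v. 0) \<longrightarrow>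
            (\<exists>\<omega> \<in> covectors (orbit_tangent gC p). \<omega> \<noteq> (\<lambda>v. 0) \<and>
              nijenhuis_dual gC \<pi>0 \<pi>kks p \<omega> = (\<lambda>v. (m p * k + r) * \<omega> v)))"
proof -
  let ?T = "orbit_tangent gC"
  have gC: "subspace (compact_form gC)"
    by (rule subspace_compact_form) fact
  have main: "nijenhuis_dual gC \<pi>0 \<pi>kks p (differential ?T U m p) v
      = (m p * k + r) * differential ?T U m p v" if p: "p \<in> U" and v: "v \<in> ?T p" for p v
  proof -
    \<comment> \<open>On tangent \<open>v\<close> the dual map is evaluation at \<open>w\<close>.
      \<open>differential_along_curve\<close> then provides one curve for \<open>v\<close> and one
      for \<open>w\<close>.\<close>
    define w where "w = nijenhuis gC \<pi>0 \<pi>kks p v"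
    have dual: "nijenhuis_dual gC \<pi>0 \<pi>kks p (differential ?T U f p) v = differential ?T U f p w"
      for f :: "'n cmat \<Rightarrow> 'b::real_normed_vector"
      using v by (simp add: nijenhuis_dual_def dual_map_def w_def)
    obtain c1 where c1: "c1 0 = p" "\<forall>\<^sub>F s in at 0. c1 s \<in> U"
      "((\<lambda>s. M (c1 s)) has_vector_derivative differential ?T U M p v) (at 0)"
      "((\<lambda>s. m (c1 s)) has_vector_derivative differential ?T U m p v) (at 0)"
      using differential_along_curve[OF gC assms(11) p, of v] assms(12,13) by metis
    obtain c2 where c2: "c2 0 = p" "\<forall>\<^sub>F s in at 0. c2 s \<in> U"
      "((\<lambda>s. M (c2 s)) has_vector_derivative differential ?T U M p w) (at 0)"
      "((\<lambda>s. m (c2 s)) has_vector_derivative differential ?T U m p w) (at 0)"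
      using differential_along_curve[OF gC assms(11) p, of w] assms(12,13) by metis
    have mult: "\<forall>\<^sub>F s in at 0. alg_multiplicity (M (c s)) (m (c s)) = alg_multiplicity (M p) (m p)"
      if "\<forall>\<^sub>F s in at 0. c s \<in> U" for c :: "real \<Rightarrow> 'n cmat"
      using that by (rule eventually_mono) (simp add: assms(16) p)
    have "differential ?T U m p w = (m p * k + r) * differential ?T U m p v"
    proof (rule eigenvalue_derivative_relation[OF _ _ _ _ assms(15)[OF p] c1(3) c2(3) c1(4) c2(4)
          mult[OF c1(2)] mult[OF c2(2)] assms(19)[OF p v]])
      show "differential ?T U M p w = dMminus p v ** M p + M p ** dMplus p v
          + r *\<^sub>C differential ?T U M p v"
        using assms(20)[OF p v] unfolding dual .
    qed (simp_all add: c1(1) c2(1))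
    then show ?thesis
      unfolding dual .
  qed
  have "\<exists>\<omega>\<in>covectors (?T p). \<omega> \<noteq> (\<lambda>v. 0) \<and>
      nijenhuis_dual gC \<pi>0 \<pi>kks p \<omega> = (\<lambda>v. (m p * k + r) * \<omega> v)"
    if p: "p \<in> U" and nz: "differential ?T U m p \<noteq> (\<lambda>v. 0)" for p
  \<comment> \<open>The witness is left open here and is fixed as the differential of
    \<open>m\<close> by the first claim shown.\<close>
  proof (intro bexI conjI)
    show "nijenhuis_dual gC \<pi>0 \<pi>kks p (differential ?T U m p)
        = (\<lambda>v. (m p * k + r) * differential ?T U m p v)"
    proof
      fix v
      show "nijenhuis_dual gC \<pi>0 \<pi>kks p (differential ?T U m p) v
          = (m p * k + r) * differential ?T U m p v"
      \<comment> \<open>Off the tangent space both sides are zero by convention.\<close>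
      proof (cases "v \<in> ?T p")
        case False
        then show ?thesis
          by (simp add: nijenhuis_dual_def dual_map_def differential_def)
      qed (rule main[OF p])
    qed
    show "differential ?T U m p \<in> covectors (?T p)"
      using gC assms(13) p by (rule differential_covector)
  qed (rule nz)
  then show ?thesis
    using main by blast
qed

end
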